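(* Let $n,c$ be positive integers, and let $V$ and $W$ be complex vector spaces of dimensions $c$ and $1$, respectively. There exists a set-theoretical bijection between the quotient space $\mathcal{M}(n,c)=\mathcal{V}(n,c)^{st}/GL(V)$ and the Hilbert scheme $\mathrm{Hilb}^{[c]}(\mathbb{C}^n)$ of $c$ points in $\mathbb{C}^n$.
   Context: $\mathcal{V}(n,c)$ is the set of tuples $(B_0,\dots,B_{n-1},I)\in\mathrm{End}(V)^{\oplus n}\oplus\mathrm{Hom}(W,V)$ with $[B_i,B_j]=0$ for all $i\ne j$. Such a tuple is stable if there is no proper subspace $S\subsetneq V$ with $B_0(S),\dots,B_{n-1}(S),I(W)\subset S$, and $\mathcal{V}(n,c)^{st}$ is the set of stable tuples in $\mathcal{V}(n,c)$. The group $GL(V)$ acts by $g\cdot(B_0,\dots,B_{n-1},I)=(gB_0g^{-1},\dots,gB_{n-1}g^{-1},gI)$, and $\mathcal{M}(n,c)$ is the set of orbits of stable tuples. As a set, $\mathrm{Hilb}^{[c]}(\mathbb{C}^n)$ is the set of ideals $J\subset\mathbb{C}[z_0,\dots,z_{n-1}]$ such that $\dim_{\mathbb{C}}(\mathbb{C}[z_0,\dots,z_{n-1}]/J)=c$. *)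

theory Defs
  imports
    Complex_Main
    "HOL-Library.Poly_Mapping"
    "HOL-Library.FuncSet"
    "HOL-Algebra.Group_Action"
    "HOL-Algebra.QuotRing"
    "HOL-Algebra.Embedded_Algebras"
begin

text \<open>
  A complex vector space is a type together with a scaling satisfying \<^locale>\<open>vector_space\<close>.
  A tuple \<open>(B\<^sub>0, \<dots>, B\<^sub>n\<^sub>-\<^sub>1, I)\<close> is a pair \<open>(B, I)\<close>, where the family \<open>B\<close> is indexed by \<^typ>\<open>nat\<close>
  and is extensional (\<^const>\<open>undefined\<close> outside \<open>{..<n}\<close>), so that equality of pairs is
  equality of tuples.
\<close>

type_synonym ('v, 'w) tuple = "(nat \<Rightarrow> 'v \<Rightarrow> 'v) \<times> ('w \<Rightarrow> 'v)"

definition Hom :: "(complex \<Rightarrow> 'a \<Rightarrow> 'a) \<Rightarrow> (complex \<Rightarrow> 'b \<Rightarrow> 'b)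
    \<Rightarrow> ('a::ab_group_add \<Rightarrow> 'b::ab_group_add) set"
  where "Hom s t = {f. Vector_Spaces.linear s t f}"

definition commutator :: "('v \<Rightarrow> 'v) \<Rightarrow> ('v \<Rightarrow> 'v) \<Rightarrow> 'v \<Rightarrow> 'v::ab_group_add"
  where "commutator A B = (\<lambda>x. A (B x) - B (A x))"

definition commuting_tuples :: "nat \<Rightarrow> (complex \<Rightarrow> 'v \<Rightarrow> 'v) \<Rightarrow> (complex \<Rightarrow> 'w \<Rightarrow> 'w)
    \<Rightarrow> ('v::ab_group_add, 'w::ab_group_add) tuple set"
  where "commuting_tuples n sV sW =
    {(B, I). B \<in> {..<n} \<rightarrow>\<^sub>E Hom sV sV \<and> I \<in> Hom sW sV \<and>
             (\<forall>i<n. \<forall>j<n. i \<noteq> j \<longrightarrow> commutator (B i) (B j) = (\<lambda>_. 0))}"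

definition stable :: "nat \<Rightarrow> (complex \<Rightarrow> 'v \<Rightarrow> 'v) \<Rightarrow> ('v::ab_group_add, 'w) tuple \<Rightarrow> bool"
  where "stable n sV = (\<lambda>(B, I).
    \<not> (\<exists>S. module.subspace sV S \<and> S \<subset> UNIV \<and> (\<forall>i<n. B i ` S \<subseteq> S) \<and> range I \<subseteq> S))"

definition stable_tuples :: "nat \<Rightarrow> (complex \<Rightarrow> 'v \<Rightarrow> 'v) \<Rightarrow> (complex \<Rightarrow> 'w \<Rightarrow> 'w)
    \<Rightarrow> ('v::ab_group_add, 'w::ab_group_add) tuple set"
  where "stable_tuples n sV sW = {X \<in> commuting_tuples n sV sW. stable n sV X}"

definition GL :: "(complex \<Rightarrow> 'v \<Rightarrow> 'v) \<Rightarrow> ('v::ab_group_add \<Rightarrow> 'v) monoid"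
  where "GL s = \<lparr>carrier = {g \<in> Hom s s. bij g}, monoid.mult = (\<circ>), one = id\<rparr>"

definition tuple_action :: "nat \<Rightarrow> ('v \<Rightarrow> 'v) \<Rightarrow> ('v, 'w) tuple \<Rightarrow> ('v, 'w) tuple"
  where "tuple_action n g = (\<lambda>(B, I). (\<lambda>i\<in>{..<n}. g \<circ> B i \<circ> inv_into UNIV g, g \<circ> I))"

definition moduli_space :: "nat \<Rightarrow> (complex \<Rightarrow> 'v \<Rightarrow> 'v) \<Rightarrow> (complex \<Rightarrow> 'w \<Rightarrow> 'w)
    \<Rightarrow> ('v::ab_group_add, 'w::ab_group_add) tuple set set"
  where "moduli_space n sV sW = orbits (GL sV) (stable_tuples n sV sW) (tuple_action n)"

lemma group_GL:
  assumes "vector_space s"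
  shows "group (GL s)"
proof -
  interpret vector_space s by fact
  interpret vector_space_pair s s ..
  have lin_inv: "Vector_Spaces.linear s s (inv_into UNIV g)"
    if "Vector_Spaces.linear s s g" "bij g" for g
  proof -
    interpret g: Vector_Spaces.linear s s g by fact
    have g: "g (inv_into UNIV g x) = x" "inv_into UNIV g (g x) = x" for x
      using that(2) by (simp_all add: bij_is_surj surj_f_inv_f bij_is_inj)
    have "inv_into UNIV g (x + y) = inv_into UNIV g x + inv_into UNIV g y" for x y
      using g(2)[of "inv_into UNIV g x + inv_into UNIV g y"] by (simp add: g.add g(1))
    moreover have "inv_into UNIV g (s a x) = s a (inv_into UNIV g x)" for a x
      using g(2)[of "s a (inv_into UNIV g x)"] by (simp add: g.scale g(1))
    ultimately show ?thesis
      by unfold_locales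
  qed
  show ?thesis
  proof (rule groupI)
    fix g assume "g \<in> carrier (GL s)"
    then show "\<exists>h\<in>carrier (GL s). h \<otimes>\<^bsub>GL s\<^esub> g = \<one>\<^bsub>GL s\<^esub>"
      by (intro bexI[of _ "inv_into UNIV g"])
         (simp_all add: GL_def Hom_def lin_inv bij_imp_bij_inv bij_is_inj)
  next
    fix g h assume "g \<in> carrier (GL s)" "h \<in> carrier (GL s)"
    then show "g \<otimes>\<^bsub>GL s\<^esub> h \<in> carrier (GL s)"
      by (auto simp: GL_def Hom_def bij_comp intro: Vector_Spaces.linear_compose)
  qed (simp_all add: GL_def Hom_def linear_id comp_assoc)
qed

text \<open>
  \<^typ>\<open>(nat \<Rightarrow>\<^sub>0 nat) \<Rightarrow>\<^sub>0 complex\<close> is the polynomial ring in the countably many variables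
  \<open>z\<^sub>0, z\<^sub>1, \<dots>\<close>: a monomial is its exponent function, and a polynomial its coefficient function.
  The polynomials whose monomials involve only \<open>z\<^sub>0, \<dots>, z\<^sub>n\<^sub>-\<^sub>1\<close> form \<open>\<complex>[z\<^sub>0, \<dots>, z\<^sub>n\<^sub>-\<^sub>1]\<close>.
\<close>

type_synonym cpoly = "(nat \<Rightarrow>\<^sub>0 nat) \<Rightarrow>\<^sub>0 complex"

definition poly_ring :: "nat \<Rightarrow> cpoly ring"
  where "poly_ring n =
    \<lparr>carrier = {p. \<forall>m\<in>Poly_Mapping.keys p. Poly_Mapping.keys m \<subseteq> {..<n}},
     monoid.mult = (*), one = 1, zero = 0, add = (+)\<rparr>"

definition const_poly :: "complex \<Rightarrow> cpoly"
  where "const_poly a = Poly_Mapping.single 0 a"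

lemma cring_poly_ring: "cring (poly_ring n)"
proof -
  let ?R = "poly_ring n"
  have car: "p \<in> carrier ?R \<longleftrightarrow> (\<forall>m\<in>Poly_Mapping.keys p. Poly_Mapping.keys m \<subseteq> {..<n})" for p
    by (simp add: poly_ring_def)
  have ops: "p \<oplus>\<^bsub>?R\<^esub> q = p + q" "p \<otimes>\<^bsub>?R\<^esub> q = p * q" "\<zero>\<^bsub>?R\<^esub> = 0" "\<one>\<^bsub>?R\<^esub> = 1" for p q
    by (simp_all add: poly_ring_def)
  have zero: "0 \<in> carrier ?R" and one: "1 \<in> carrier ?R"
    by (simp_all add: car)
  have uminus: "- p \<in> carrier ?R" if "p \<in> carrier ?R" for p
    using that by (simp add: car)
  have add: "p + q \<in> carrier ?R" if "p \<in> carrier ?R" "q \<in> carrier ?R" for p q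
    using that keys_add[of p q] unfolding car by blast
  have mult: "p * q \<in> carrier ?R" if "p \<in> carrier ?R" "q \<in> carrier ?R" for p q
    unfolding car
  proof
    fix m assume "m \<in> Poly_Mapping.keys (p * q)"
    then obtain a b where "m = a + b" "a \<in> Poly_Mapping.keys p" "b \<in> Poly_Mapping.keys q"
      using keys_mult[of p q] by blast
    then show "Poly_Mapping.keys m \<subseteq> {..<n}"
      using that keys_add[of a b] unfolding car by blast
  qed
  show ?thesis
  proof (rule cringI)
    show "abelian_group ?R"
    proof (rule abelian_groupI)
      fix p assume "p \<in> carrier ?R"
      then show "\<exists>q\<in>carrier ?R. q \<oplus>\<^bsub>?R\<^esub> p = \<zero>\<^bsub>?R\<^esub>"
        by (intro bexI[of _ "- p"]) (simp_all add: ops uminus)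
    qed (simp_all add: ops zero add ac_simps)
    show "comm_monoid ?R"
      by (rule comm_monoidI) (simp_all add: ops one mult ac_simps)
  qed (simp add: ops distrib_right)
qed

text \<open>
  The scalars act on the quotient ring through the classes of the constant polynomials, so
  the complex dimension of the quotient is its dimension over the subring of these classes.
  That subring is a copy of \<open>\<complex>\<close> unless \<open>J\<close> is the whole ring, in which case
  only dimension \<open>0\<close> is possible.
\<close>

definition Hilb :: "nat \<Rightarrow> nat \<Rightarrow> cpoly set set"
  where "Hilb n c = {J. ideal J (poly_ring n) \<and>
    ring.dimension (poly_ring n Quot J) c
      ((\<lambda>a. J +>\<^bsub>poly_ring n\<^esub> const_poly a) ` UNIV) (carrier (poly_ring n Quot J))}"

end

theory Submission
  imports Defs
begin

text \<open>
  A commuting family \<open>B\<close> makes \<open>V\<close> a module over \<open>R = \<complex>[z\<^sub>0, \<dots>, z\<^sub>n\<^sub>-\<^sub>1]\<close> in which \<open>z\<^sub>i\<close> acts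
  as \<open>B\<^sub>i\<close>, and a map \<open>I\<close> from a line is the choice of a vector \<open>v = I w\<close>, for a fixed \<open>w \<noteq> 0\<close>.
  The image of \<open>R \<rightarrow> V\<close>, \<open>p \<mapsto> p(B) v\<close>, is the smallest invariant subspace that contains \<open>v\<close>, so
  stability says exactly that this map is onto (\<open>stable_iff_surj\<close>). A stable tuple is thus the
  same thing as a cyclic \<open>R\<close>-module structure on \<open>V\<close> with a chosen generator. Such a structure is
  determined up to isomorphism by the annihilator \<open>J\<close> of the generator, since \<open>V \<cong> R/J\<close>, and
  isomorphisms that respect the generators are precisely the elements of \<open>GL(V)\<close> that carry
  one tuple to the other. The bijection sends the orbit of a tuple to \<open>J\<close>.

  Modules are not constructed explicitly. The proof works with the linear maps \<open>\<phi>: R \<rightarrow> V\<close> that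
  satisfy \<open>\<phi> 1 = v\<close> and \<open>\<phi> (z\<^sub>i p) = B\<^sub>i (\<phi> p)\<close> (\<open>presents\<close>). For given \<open>B\<close> and \<open>v\<close> there is only
  one (\<open>presents_unique\<close>), and for commuting \<open>B\<close> evaluation provides it (\<open>presents_eval\<close>).
  The rest is linear algebra. A linear map that vanishes on the kernel of a surjection factors
  through it (\<open>factor_through_surj\<close>): this yields the element of \<open>GL(V)\<close> that relates two
  tuples with the same annihilator, and it yields the operators \<open>B\<^sub>i\<close> on \<open>V\<close> from the
  multiplications by \<open>z\<^sub>i\<close> when an ideal \<open>J\<close> of codimension \<open>c\<close> is given together with some
  linear surjection \<open>R \<rightarrow> V\<close> with kernel \<open>J\<close>. That such a surjection exists if and only if \<open>R/J\<close>
  has dimension \<open>c\<close> over the image of \<open>\<complex>\<close> is the content of \<open>dimension_if_surj\<close> and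
  \<open>surj_if_dimension\<close>.
\<close>

section \<open>The polynomial ring\<close>

abbreviation polys :: "nat \<Rightarrow> cpoly set"
  where "polys n \<equiv> carrier (poly_ring n)"

definition var :: "nat \<Rightarrow> cpoly"
  where "var i = Poly_Mapping.single (Poly_Mapping.single i 1) 1"

lemma poly_ring_simps [simp]:
  "p \<oplus>\<^bsub>poly_ring n\<^esub> q = p + q" "p \<otimes>\<^bsub>poly_ring n\<^esub> q = p * q"
  "\<zero>\<^bsub>poly_ring n\<^esub> = 0" "\<one>\<^bsub>poly_ring n\<^esub> = 1"
  by (simp_all add: poly_ring_def)

lemma mem_polys: "p \<in> polys n \<longleftrightarrow> (\<forall>m\<in>Poly_Mapping.keys p. Poly_Mapping.keys m \<subseteq> {..<n})"
  by (simp add: poly_ring_def)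

lemma polys_0 [simp]: "0 \<in> polys n" and polys_1 [simp]: "1 \<in> polys n"
  by (simp_all add: mem_polys)

lemma polys_add [simp]: "p \<in> polys n \<Longrightarrow> q \<in> polys n \<Longrightarrow> p + q \<in> polys n"
  using ring.ring_simprules(1)[OF cring.axioms(1)[OF cring_poly_ring], of p n q] by simp

lemma polys_mult [simp]: "p \<in> polys n \<Longrightarrow> q \<in> polys n \<Longrightarrow> p * q \<in> polys n"
  using ring.ring_simprules(5)[OF cring.axioms(1)[OF cring_poly_ring], of p n q] by simp

lemma polys_const [simp]: "const_poly a \<in> polys n"
  by (simp add: mem_polys const_poly_def)

lemma polys_var [simp]: "i < n \<Longrightarrow> var i \<in> polys n"
  by (simp add: mem_polys var_def)

lemma polys_uminus [simp]: "p \<in> polys n \<Longrightarrow> - p \<in> polys n"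
  by (simp add: mem_polys)

lemma polys_diff [simp]: "p \<in> polys n \<Longrightarrow> q \<in> polys n \<Longrightarrow> p - q \<in> polys n"
  using polys_add[of p n "- q"] by simp

lemma const_poly_simps [simp]:
  "const_poly 0 = 0" "const_poly 1 = 1" "const_poly (a + b) = const_poly a + const_poly b"
  "const_poly (a * b) = const_poly a * const_poly b" "const_poly (- a) = - const_poly a"
  by (simp_all add: const_poly_def single_add mult_single single_uminus)

lemma poly_eq_sum_single:
  fixes p :: cpoly
  shows "p = (\<Sum>m\<in>Poly_Mapping.keys p. Poly_Mapping.single m (Poly_Mapping.lookup p m))"
  by (rule poly_mapping_eqI)
    (auto simp: lookup_sum lookup_single when_def in_keys_iff)

lemma poly_additive_induct [case_names zero single add]:
  fixes p :: cpoly
  assumes "P 0"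
    and "\<And>m a. m \<in> Poly_Mapping.keys p \<Longrightarrow> P (Poly_Mapping.single m a)"
    and "\<And>q r. P q \<Longrightarrow> P r \<Longrightarrow> P (q + r)"
  shows "P p"
proof -
  have "P (\<Sum>m\<in>A. Poly_Mapping.single m (Poly_Mapping.lookup p m))"
    if "finite A" "A \<subseteq> Poly_Mapping.keys p" for A
    using that by (induction rule: finite_induct) (auto intro: assms)
  from this[OF finite_keys order_refl] show ?thesis
    by (simp flip: poly_eq_sum_single)
qed

text \<open>
  Multiplication by variables builds every monomial from a constant, so a property of all
  polynomials in \<open>z\<^sub>0, \<dots>, z\<^sub>n\<^sub>-\<^sub>1\<close> follows from closure under sums and under multiplication by a
  variable. The proof is by induction on the total degree of a monomial.
\<close>

lemma polys_induct [consumes 1, case_names const add var]: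
  assumes "p \<in> polys n"
    and const: "\<And>a. P (const_poly a)"
    and add: "\<And>p q. \<lbrakk>p \<in> polys n; q \<in> polys n; P p; P q\<rbrakk> \<Longrightarrow> P (p + q)"
    and var: "\<And>i p. \<lbrakk>i < n; p \<in> polys n; P p\<rbrakk> \<Longrightarrow> P (var i * p)"
  shows "P p"
proof -
  have mono: "Poly_Mapping.single m a \<in> polys n \<and> P (Poly_Mapping.single m a)"
    if "Poly_Mapping.keys m \<subseteq> {..<n}" for m :: "nat \<Rightarrow>\<^sub>0 nat" and a
    using that
  proof (induction "\<Sum>i<n. Poly_Mapping.lookup m i" arbitrary: m)
    case 0
    then have "Poly_Mapping.lookup m i = 0" for i
      by (cases "i < n") (auto simp: in_keys_iff)
    then have "m = 0"
      by (auto intro: poly_mapping_eqI)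
    then show ?case
      using const[of a] by (simp flip: const_poly_def)
  next
    case (Suc k)
    then have "(\<Sum>i<n. Poly_Mapping.lookup m i) \<noteq> 0"
      by linarith
    then obtain i where i: "i < n" "Poly_Mapping.lookup m i \<noteq> 0"
      by (meson lessThan_iff sum.neutral)
    define m' where "m' = m - Poly_Mapping.single i 1"
    have m: "m = Poly_Mapping.single i 1 + m'"
      using i(2) by (intro poly_mapping_eqI)
        (auto simp: m'_def lookup_add lookup_minus lookup_single when_def)
    have "(\<Sum>j<n. Poly_Mapping.lookup m j) = Suc (\<Sum>j<n. Poly_Mapping.lookup m' j)"
      using i(1) by (simp add: m lookup_add sum.distrib lookup_single when_def)
    moreover have "Poly_Mapping.keys m' \<subseteq> {..<n}"
      using Suc.prems by (auto simp: m lookup_add in_keys_iff subset_eq)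
    ultimately have "Poly_Mapping.single m' a \<in> polys n" "P (Poly_Mapping.single m' a)"
      using Suc.hyps(1)[of m'] Suc.hyps(2) by simp_all
    moreover have "Poly_Mapping.single m a = var i * Poly_Mapping.single m' a"
      by (simp add: var_def mult_single m)
    ultimately show ?case
      using i var by simp
  qed
  have "p \<in> polys n \<and> P p"
  proof (induction p rule: poly_additive_induct)
    case zero
    show ?case using const[of 0] by simp
  next
    case (single m a)
    then show ?case using assms(1) by (intro mono) (simp add: mem_polys)
  next
    case (add q r)
    then show ?case using assms(3) by simp
  qed
  then show ?thesis ..
qed

section \<open>Ideals and cosets of the polynomial ring\<close>

lemma ideal_polysI:
  assumes "J \<subseteq> polys n" "0 \<in> J"
    and add: "\<And>p q. p \<in> J \<Longrightarrow> q \<in> J \<Longrightarrow> p + q \<in> J"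
    and mult: "\<And>p q. p \<in> J \<Longrightarrow> q \<in> polys n \<Longrightarrow> q * p \<in> J"
  shows "ideal J (poly_ring n)"
proof -
  interpret cring "poly_ring n"
    by (rule cring_poly_ring)
  show ?thesis
  proof (rule idealI)
    show "subgroup J (add_monoid (poly_ring n))"
    proof (rule add.subgroupI)
      show "\<ominus>\<^bsub>poly_ring n\<^esub> p \<in> J" if "p \<in> J" for p
      proof -
        have "\<ominus>\<^bsub>poly_ring n\<^esub> p = - p"
          using that assms(1) by (intro minus_equality) auto
        then show ?thesis
          using mult[OF that, of "const_poly (- 1)"] by simp
      qed
    qed (use assms in auto)
  qed (use mult ring_axioms in \<open>auto simp: mult.commute\<close>)
qed

lemma idealD:
  assumes "ideal J (poly_ring n)"
  shows "J \<subseteq> polys n" "0 \<in> J"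
    and "\<And>p q. p \<in> J \<Longrightarrow> q \<in> J \<Longrightarrow> p + q \<in> J"
    and "\<And>p q. p \<in> J \<Longrightarrow> q \<in> polys n \<Longrightarrow> q * p \<in> J"
    and "\<And>p. p \<in> J \<Longrightarrow> - p \<in> J"
    and "\<And>p q. p \<in> J \<Longrightarrow> q \<in> J \<Longrightarrow> p - q \<in> J"
proof -
  interpret ideal J "poly_ring n"
    by fact
  show "J \<subseteq> polys n" "0 \<in> J"
    using a_subset additive_subgroup.zero_closed[OF is_additive_subgroup] by simp_all
  show add: "p + q \<in> J" if "p \<in> J" "q \<in> J" for p q
    using additive_subgroup.a_closed[OF is_additive_subgroup that] by simp
  show mult: "q * p \<in> J" if "p \<in> J" "q \<in> polys n" for p q
    using I_l_closed[OF that] by simp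
  show uminus: "- p \<in> J" if "p \<in> J" for p
    using mult[OF that, of "const_poly (- 1)"] by simp
  show "p - q \<in> J" if "p \<in> J" "q \<in> J" for p q
    using add[OF that(1) uminus[OF that(2)]] by simp
qed

abbreviation coset :: "nat \<Rightarrow> cpoly set \<Rightarrow> cpoly \<Rightarrow> cpoly set"
  where "coset n J p \<equiv> J +>\<^bsub>poly_ring n\<^esub> p"

lemma coset_eq_iff:
  assumes "ideal J (poly_ring n)"
  shows "coset n J p = coset n J q \<longleftrightarrow> p - q \<in> J"
proof
  assume "coset n J p = coset n J q"
  moreover have "p \<in> coset n J p"
    using idealD(2)[OF assms] by (force simp: a_r_coset_def')
  ultimately show "p - q \<in> J"
    by (auto simp: a_r_coset_def')
next
  have sub: "coset n J p \<subseteq> coset n J q" if "p - q \<in> J" for p q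
  proof
    fix x assume "x \<in> coset n J p"
    then obtain j where "j \<in> J" "x = j + p"
      by (auto simp: a_r_coset_def')
    then have "x = (j + (p - q)) + q" "j + (p - q) \<in> J"
      using that idealD(3)[OF assms] by simp_all
    then show "x \<in> coset n J q"
      unfolding a_r_coset_def' by (metis UN_iff poly_ring_simps(1) singletonI)
  qed
  assume "p - q \<in> J"
  moreover have "q - p \<in> J"
    using idealD(5)[OF assms \<open>p - q \<in> J\<close>] by simp
  ultimately show "coset n J p = coset n J q"
    using sub by blast
qed

abbreviation scalars :: "nat \<Rightarrow> cpoly set \<Rightarrow> cpoly set set"
  where "scalars n J \<equiv> (\<lambda>a. coset n J (const_poly a)) ` UNIV"

lemma quot_carrier: "carrier (poly_ring n Quot J) = coset n J ` polys n"
  by (auto simp: FactRing_def A_RCOSETS_defs a_r_coset_def)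

text \<open>
  The induction rules for the dimension of a quotient ring add one line at a time. Lifting such
  a step to representatives lets the dimension be computed with polynomials.
\<close>

lemma line_extension_cosets:
  assumes "ideal J (poly_ring n)" "q \<in> polys n" "T \<subseteq> polys n"
  shows "ring.line_extension (poly_ring n Quot J) (scalars n J) (coset n J q) (coset n J ` T)
    = coset n J ` {const_poly a * q + t | a t. t \<in> T}"
proof -
  interpret ideal J "poly_ring n"
    by fact
  interpret Q: ring "poly_ring n Quot J"
    by (rule quotient_is_ring)
  have mult: "coset n J p \<otimes>\<^bsub>poly_ring n Quot J\<^esub> coset n J r = coset n J (p * r)"
    if "p \<in> polys n" "r \<in> polys n" for p r
    using ring_hom_mult[OF rcos_ring_hom that] by simp
  have add: "coset n J p \<oplus>\<^bsub>poly_ring n Quot J\<^esub> coset n J r = coset n J (p + r)"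
    if "p \<in> polys n" "r \<in> polys n" for p r
    using ring_hom_add[OF rcos_ring_hom that] by simp
  have "ring.line_extension (poly_ring n Quot J) (scalars n J) (coset n J q) (coset n J ` T)
    = (\<Union>a. \<Union>t\<in>T. {(coset n J (const_poly a) \<otimes>\<^bsub>poly_ring n Quot J\<^esub> coset n J q)
        \<oplus>\<^bsub>poly_ring n Quot J\<^esub> coset n J t})"
    unfolding Q.line_extension_def set_add_def' r_coset_def by blast
  also have "\<dots> = (\<Union>a. \<Union>t\<in>T. {coset n J (const_poly a * q + t)})"
    using assms(2,3) by (intro SUP_cong refl) (simp add: mult add subset_eq)
  also have "\<dots> = coset n J ` {const_poly a * q + t | a t. t \<in> T}"
    by (simp add: image_def) blast
  finally show ?thesis .
qed

section \<open>Evaluating a polynomial at commuting endomorphisms\<close>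

text \<open>
  The operator \<open>B\<^sub>k\<^sub>-\<^sub>1\<^bsup>m(k-1)\<^esup> \<circ> \<dots> \<circ> B\<^sub>0\<^bsup>m(0)\<^esup>\<close>, which is the value of the monomial \<open>m\<close> at a commuting
  family \<open>B\<close>. The factors are put in a fixed order so that it makes sense for every family.
\<close>

primrec monomial_op :: "(nat \<Rightarrow> 'v \<Rightarrow> 'v) \<Rightarrow> nat \<Rightarrow> (nat \<Rightarrow>\<^sub>0 nat) \<Rightarrow> 'v \<Rightarrow> 'v"
  where
    "monomial_op B 0 m = id"
  | "monomial_op B (Suc k) m = (B k ^^ Poly_Mapping.lookup m k) \<circ> monomial_op B k m"

lemma monomial_op_0 [simp]: "monomial_op B k 0 = id"
  by (induction k) simp_all

lemma monomial_op_cong: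
  "(\<And>i. i < k \<Longrightarrow> Poly_Mapping.lookup m i = Poly_Mapping.lookup m' i)
    \<Longrightarrow> monomial_op B k m = monomial_op B k m'"
  by (induction k) simp_all

lemma funpow_commute:
  assumes "\<And>x. f (g x) = g (f x)"
  shows "(f ^^ e) (g x) = g ((f ^^ e) x)"
  by (induction e) (simp_all add: assms)

text \<open>
  The new factor \<open>B\<^sub>i\<close> enters at position \<open>i\<close> of the product and moves to the front past the
  powers of the later operators.
\<close>

lemma monomial_op_var:
  assumes "\<And>i j x. i < k \<Longrightarrow> j < k \<Longrightarrow> B i (B j x) = B j (B i x)" and "i < k"
  shows "monomial_op B k (Poly_Mapping.single i 1 + m) x = B i (monomial_op B k m x)"
  using assms
proof (induction k)
  case (Suc k)
  show ?case
  proof (cases "i = k")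
    case True
    then have "monomial_op B k (Poly_Mapping.single i 1 + m) = monomial_op B k m"
      by (intro monomial_op_cong) (simp add: lookup_add lookup_single)
    with True show ?thesis
      by (simp add: lookup_add)
  next
    case False
    with Suc.prems(2) have "i < k"
      by simp
    with Suc have "monomial_op B k (Poly_Mapping.single i 1 + m) x = B i (monomial_op B k m x)"
      by simp
    with False \<open>i < k\<close> show ?thesis
      by (simp add: lookup_add lookup_single funpow_commute[of "B k" "B i"] Suc.prems)
  qed
qed simp

locale complex_space = vector_space scale
  for scale :: "complex \<Rightarrow> 'v::ab_group_add \<Rightarrow> 'v"
begin

abbreviation lin :: "('v \<Rightarrow> 'v) \<Rightarrow> bool"
  where "lin \<equiv> Vector_Spaces.linear scale scale"

definition eval :: "nat \<Rightarrow> (nat \<Rightarrow> 'v \<Rightarrow> 'v) \<Rightarrow> 'v \<Rightarrow> cpoly \<Rightarrow> 'v"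
  where "eval n B v p =
    (\<Sum>m\<in>Poly_Mapping.keys p. scale (Poly_Mapping.lookup p m) (monomial_op B n m v))"

text \<open>
  The type of polynomials has infinitely many variables, so linearity is required on the
  subring in \<open>z\<^sub>0, \<dots>, z\<^sub>n\<^sub>-\<^sub>1\<close> only.
\<close>

definition polylinear :: "nat \<Rightarrow> (cpoly \<Rightarrow> 'v) \<Rightarrow> bool"
  where "polylinear n \<phi> \<longleftrightarrow>
    (\<forall>p\<in>polys n. \<forall>q\<in>polys n. \<phi> (p + q) = \<phi> p + \<phi> q) \<and>
    (\<forall>a. \<forall>p\<in>polys n. \<phi> (const_poly a * p) = scale a (\<phi> p))"

text \<open>
  When the \<open>B\<^sub>i\<close> commute, this is the homomorphism of modules from the polynomial ring to \<open>V\<close>,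
  with \<open>z\<^sub>i\<close> acting as \<open>B\<^sub>i\<close>, that sends \<open>1\<close> to \<open>v\<close>.
\<close>

definition presents :: "nat \<Rightarrow> (nat \<Rightarrow> 'v \<Rightarrow> 'v) \<Rightarrow> 'v \<Rightarrow> (cpoly \<Rightarrow> 'v) \<Rightarrow> bool"
  where "presents n B v \<phi> \<longleftrightarrow>
    polylinear n \<phi> \<and> \<phi> 1 = v \<and> (\<forall>i<n. \<forall>p\<in>polys n. \<phi> (var i * p) = B i (\<phi> p))"

definition ker :: "nat \<Rightarrow> (cpoly \<Rightarrow> 'v) \<Rightarrow> cpoly set"
  where "ker n \<phi> = {p \<in> polys n. \<phi> p = 0}"

lemma polylinearD:
  assumes "polylinear n \<phi>"
  shows "\<lbrakk>p \<in> polys n; q \<in> polys n\<rbrakk> \<Longrightarrow> \<phi> (p + q) = \<phi> p + \<phi> q"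
    and "p \<in> polys n \<Longrightarrow> \<phi> (const_poly a * p) = scale a (\<phi> p)"
    and "\<phi> 0 = 0"
    and "p \<in> polys n \<Longrightarrow> \<phi> (- p) = - \<phi> p"
    and "\<lbrakk>p \<in> polys n; q \<in> polys n\<rbrakk> \<Longrightarrow> \<phi> (p - q) = \<phi> p - \<phi> q"
    and "\<phi> (const_poly a) = scale a (\<phi> 1)"
proof -
  show add: "\<phi> (p + q) = \<phi> p + \<phi> q" if "p \<in> polys n" "q \<in> polys n" for p q
    using assms that by (simp add: polylinear_def)
  have scale: "\<phi> (const_poly a * p) = scale a (\<phi> p)" if "p \<in> polys n" for a p
    using assms that by (simp add: polylinear_def)
  then show "p \<in> polys n \<Longrightarrow> \<phi> (const_poly a * p) = scale a (\<phi> p)" .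
  show "\<phi> 0 = 0"
    using scale[of 0 0] by simp
  show uminus: "\<phi> (- p) = - \<phi> p" if "p \<in> polys n" for p
    using scale[OF that, of "-1"] by simp
  show "\<phi> (p - q) = \<phi> p - \<phi> q" if "p \<in> polys n" "q \<in> polys n"
    using add[of p "- q"] uminus that by simp
  show "\<phi> (const_poly a) = scale a (\<phi> 1)"
    using scale[of 1 a] by simp
qed

lemma eval_superset:
  assumes "finite A" "Poly_Mapping.keys p \<subseteq> A"
  shows "eval n B v p = (\<Sum>m\<in>A. scale (Poly_Mapping.lookup p m) (monomial_op B n m v))"
  unfolding eval_def using assms
  by (intro sum.mono_neutral_left) (auto simp: in_keys_iff)

lemma eval_0 [simp]: "eval n B v 0 = 0"
  by (simp add: eval_def)

lemma eval_single: "eval n B v (Poly_Mapping.single m a) = scale a (monomial_op B n m v)"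
  by (simp add: eval_def)

lemma eval_add: "eval n B v (p + q) = eval n B v p + eval n B v q"
proof -
  let ?A = "Poly_Mapping.keys p \<union> Poly_Mapping.keys q"
  have "Poly_Mapping.keys (p + q) \<subseteq> ?A"
    by (rule keys_add)
  then show ?thesis
    by (simp add: eval_superset[of ?A] lookup_add scale_left_distrib sum.distrib)
qed

lemma eval_const_mult: "eval n B v (const_poly a * p) = scale a (eval n B v p)"
  by (induction p rule: poly_additive_induct)
    (simp_all add: const_poly_def mult_single eval_single eval_add distrib_left scale_right_distrib)

lemma eval_var_mult:
  assumes "\<And>i j x. i < n \<Longrightarrow> j < n \<Longrightarrow> B i (B j x) = B j (B i x)"
    and "\<And>i. i < n \<Longrightarrow> lin (B i)" and "i < n"
  shows "eval n B v (var i * p) = B i (eval n B v p)"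
proof -
  interpret B: Vector_Spaces.linear scale scale "B i"
    using assms(2,3) .
  show ?thesis
  proof (induction p rule: poly_additive_induct)
    case (single m a)
    show ?case
      using monomial_op_var[of n B i m v] assms(1,3)
      by (simp add: var_def mult_single eval_single B.scale)
  qed (simp_all add: B.zero B.add eval_add distrib_left)
qed

lemma presents_eval:
  assumes "\<And>i j x. i < n \<Longrightarrow> j < n \<Longrightarrow> B i (B j x) = B j (B i x)"
    and "\<And>i. i < n \<Longrightarrow> lin (B i)"
  shows "presents n B v (eval n B v)"
  using assms eval_single[of n B v 0 1]
  by (auto simp: presents_def polylinear_def eval_add eval_const_mult eval_var_mult)

lemma presents_unique:
  assumes "presents n B v \<phi>" "presents n B v \<psi>" "p \<in> polys n"
  shows "\<phi> p = \<psi> p"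
  using assms(3)
proof (induction rule: polys_induct)
  case (const a)
  show ?case
    using assms(1,2) polylinearD(6)[of n \<phi>] polylinearD(6)[of n \<psi>] by (simp add: presents_def)
next
  case (add p q)
  then show ?case
    using assms(1,2) polylinearD(1)[of n \<phi>] polylinearD(1)[of n \<psi>] by (simp add: presents_def)
next
  case (var i p)
  then show ?case
    using assms(1,2) by (simp add: presents_def)
qed

text \<open>
  Every \<open>\<phi> p\<close> is obtained from \<open>v\<close> by linear combinations and the operators \<open>B\<^sub>i\<close>, so it lies in
  each invariant subspace that contains \<open>v\<close>.
\<close>

lemma presents_range_minimal:
  assumes "presents n B v \<phi>" "subspace S" "v \<in> S" "\<And>i. i < n \<Longrightarrow> B i ` S \<subseteq> S" "p \<in> polys n"
  shows "\<phi> p \<in> S"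
  using assms(5)
proof (induction rule: polys_induct)
  case (const a)
  show ?case
    using assms(1-3) by (simp add: presents_def polylinearD(6)[of n \<phi>] subspace_scale)
next
  case (add p q)
  then show ?case
    using assms(1,2) by (simp add: presents_def polylinearD(1)[of n \<phi>] subspace_add)
next
  case (var i p)
  then show ?case
    using assms(1,4) by (auto simp: presents_def)
qed

lemma subspace_range:
  assumes "polylinear n \<phi>"
  shows "subspace (\<phi> ` polys n)"
proof (rule subspaceI)
  show "0 \<in> \<phi> ` polys n"
    using polylinearD(3)[OF assms] by (metis image_eqI polys_0)
  show "x + y \<in> \<phi> ` polys n" if "x \<in> \<phi> ` polys n" "y \<in> \<phi> ` polys n" for x y
  proof -
    obtain p where "p \<in> polys n" "x = \<phi> p"
      using \<open>x \<in> \<phi> ` polys n\<close> by blast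
    moreover obtain q where "q \<in> polys n" "y = \<phi> q"
      using \<open>y \<in> \<phi> ` polys n\<close> by blast
    ultimately have "x + y = \<phi> (p + q)" "p + q \<in> polys n"
      by (simp_all add: polylinearD(1)[OF assms])
    then show ?thesis
      by blast
  qed
  show "scale a x \<in> \<phi> ` polys n" if "x \<in> \<phi> ` polys n" for a x
  proof -
    obtain p where "p \<in> polys n" "x = \<phi> p"
      using \<open>x \<in> \<phi> ` polys n\<close> by blast
    then have "scale a x = \<phi> (const_poly a * p)" "const_poly a * p \<in> polys n"
      by (simp_all add: polylinearD(2)[OF assms])
    then show ?thesis
      by blast
  qed
qed

text \<open>
  The range of \<open>\<phi>\<close> is itself an invariant subspace that contains \<open>v\<close>, hence it is the smallest
  one; stability says that the smallest one is \<open>V\<close>.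
\<close>

lemma stable_iff_surj:
  assumes "presents n B v \<phi>" and "range I = range (\<lambda>a. scale a v)"
  shows "stable n scale (B, I) \<longleftrightarrow> \<phi> ` polys n = UNIV"
proof
  assume st: "stable n scale (B, I)"
  have \<phi>: "polylinear n \<phi>" "\<phi> 1 = v"
    using assms(1) by (simp_all add: presents_def)
  have "B i ` \<phi> ` polys n \<subseteq> \<phi> ` polys n" if "i < n" for i
  proof
    fix x assume "x \<in> B i ` \<phi> ` polys n"
    then obtain p where "p \<in> polys n" "x = B i (\<phi> p)"
      by blast
    then have "x = \<phi> (var i * p)" "var i * p \<in> polys n"
      using assms(1) that by (simp_all add: presents_def)
    then show "x \<in> \<phi> ` polys n"
      by blast
  qed
  moreover have "range I \<subseteq> \<phi> ` polys n"
  proof -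
    have "scale a v \<in> \<phi> ` polys n" for a
      using polylinearD(6)[OF \<phi>(1), of a] polys_const[of a n] \<phi>(2) by (metis image_eqI)
    then show ?thesis
      unfolding assms(2) by blast
  qed
  ultimately show "\<phi> ` polys n = UNIV"
    using st subspace_range[OF \<phi>(1)] unfolding stable_def by blast
next
  assume surj: "\<phi> ` polys n = UNIV"
  have "S = UNIV" if "subspace S" "\<And>i. i < n \<Longrightarrow> B i ` S \<subseteq> S" "range I \<subseteq> S" for S
  proof -
    have "scale 1 v \<in> S"
      using that(3) assms(2) by blast
    then have "\<phi> ` polys n \<subseteq> S"
      using presents_range_minimal[OF assms(1)] that by auto
    with surj show ?thesis
      by blast
  qed
  then show "stable n scale (B, I)"
    unfolding stable_def by blast
qed

text \<open>
  The homomorphism theorem: \<open>g v\<close> is \<open>\<psi>\<close> of any preimage of \<open>v\<close> under \<open>\<phi>\<close>, and the inclusion of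
  the kernels makes the choice irrelevant.
\<close>

lemma factor_through_surj:
  assumes "polylinear n \<phi>" "\<phi> ` polys n = UNIV" "polylinear n \<psi>" "ker n \<phi> \<subseteq> ker n \<psi>"
  shows "\<exists>g. lin g \<and> (\<forall>p\<in>polys n. g (\<phi> p) = \<psi> p)"
proof -
  have "\<forall>v. \<exists>p. p \<in> polys n \<and> \<phi> p = v"
    using assms(2) by (metis UNIV_I imageE)
  then obtain r where r: "\<And>v. r v \<in> polys n" "\<And>v. \<phi> (r v) = v"
    by metis
  define g where "g v = \<psi> (r v)" for v
  have g: "g (\<phi> p) = \<psi> p" if "p \<in> polys n" for p
  proof -
    have "r (\<phi> p) - p \<in> ker n \<phi>"
      using that by (simp add: ker_def r polylinearD(5)[OF assms(1)])
    then have "r (\<phi> p) - p \<in> ker n \<psi>"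
      using assms(4) by blast
    then show ?thesis
      using that by (simp add: ker_def g_def r polylinearD(5)[OF assms(3)])
  qed
  have "g (x + y) = g x + g y" for x y
    using g[of "r x + r y"] by (simp add: g_def r polylinearD(1)[OF assms(1)] polylinearD(1)[OF assms(3)])
  moreover have "g (scale a x) = scale a (g x)" for a x
    using g[of "const_poly a * r x"]
    by (simp add: g_def r polylinearD(2)[OF assms(1)] polylinearD(2)[OF assms(3)])
  ultimately have "lin g"
    by unfold_locales
  with g show ?thesis
    by blast
qed

lemma ideal_ker:
  assumes "presents n B v \<phi>" "\<And>i. i < n \<Longrightarrow> lin (B i)"
  shows "ideal (ker n \<phi>) (poly_ring n)"
proof (rule ideal_polysI)
  have \<phi>: "polylinear n \<phi>"
    using assms(1) by (simp add: presents_def)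
  show "0 \<in> ker n \<phi>" "ker n \<phi> \<subseteq> polys n"
    by (auto simp: ker_def polylinearD(3)[OF \<phi>])
  show "p + q \<in> ker n \<phi>" if "p \<in> ker n \<phi>" "q \<in> ker n \<phi>" for p q
    using that by (simp add: ker_def polylinearD(1)[OF \<phi>])
  show "q * p \<in> ker n \<phi>" if "p \<in> ker n \<phi>" "q \<in> polys n" for p q
    using that(2)
  proof (induction rule: polys_induct)
    case (const a)
    then show ?case
      using that(1) by (simp add: ker_def polylinearD(2)[OF \<phi>])
  next
    case (add q r)
    then show ?case
      using that(1) by (simp add: ker_def polylinearD(1)[OF \<phi>] distrib_right)
  next
    case (var i q)
    interpret B: Vector_Spaces.linear scale scale "B i"
      using assms(2) var(1) .
    show ?case
      using var that(1) assms(1) by (simp add: ker_def presents_def mult.assoc B.zero)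
  qed
qed

end

section \<open>The dimension of a quotient ring\<close>

context complex_space
begin

text \<open>
  For a basis \<open>B\<close> of \<open>V\<close> this says that \<open>R/ker \<phi>\<close> has the dimension of \<open>V\<close>. The general form lets
  \<open>B\<close> grow one vector at a time: a preimage of the new vector spans the line that extends the
  cosets of the preimage of the old span.
\<close>

lemma dimension_if_surj:
  assumes "polylinear n \<phi>" "\<phi> ` polys n = UNIV" "ideal (ker n \<phi>) (poly_ring n)"
    and "finite B" "independent B"
  shows "ring.dimension (poly_ring n Quot ker n \<phi>) (card B) (scalars n (ker n \<phi>))
    (coset n (ker n \<phi>) ` {p \<in> polys n. \<phi> p \<in> span B})"
  using assms(4,5)
proof (induction rule: finite_induct)
  let ?J = "ker n \<phi>"
  case empty
  let ?T = "{p \<in> polys n. \<phi> p \<in> span {}}"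
  have "coset n ?J ` ?T = (\<lambda>_. coset n ?J 0) ` ?T"
  proof (rule image_cong[OF refl])
    fix p assume "p \<in> ?T"
    then have "p - 0 \<in> ?J"
      by (simp add: ker_def)
    then show "coset n ?J p = coset n ?J 0"
      unfolding coset_eq_iff[OF assms(3)] .
  qed
  also have "\<dots> = {coset n ?J 0}"
    by (rule image_constant[of 0]) (simp add: polylinearD(3)[OF assms(1)])
  also have "coset n ?J 0 = \<zero>\<^bsub>poly_ring n Quot ?J\<^esub>"
    by (simp add: a_r_coset_def' FactRing_def)
  finally have "coset n ?J ` ?T = {\<zero>\<^bsub>poly_ring n Quot ?J\<^esub>}" .
  then show ?case
    using ring.zero_dim[OF ideal.quotient_is_ring[OF assms(3)]] by simp
next
  let ?J = "ker n \<phi>"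
  case (insert b B)
  let ?T = "{p \<in> polys n. \<phi> p \<in> span B}"
  have B: "independent B" "b \<notin> span B"
    using insert by (auto simp: independent_insert)
  have "b \<in> \<phi> ` polys n"
    unfolding assms(2) by simp
  then obtain q where q: "q \<in> polys n" "\<phi> q = b"
    by blast
  have "coset n ?J q \<notin> coset n ?J ` ?T"
  proof
    assume "coset n ?J q \<in> coset n ?J ` ?T"
    then obtain t where "t \<in> polys n" "\<phi> t \<in> span B" "q - t \<in> ?J"
      by (auto simp: coset_eq_iff[OF assms(3)])
    then show False
      using B(2) q by (simp add: ker_def polylinearD(5)[OF assms(1)])
  qed
  moreover have "coset n ?J q \<in> carrier (poly_ring n Quot ?J)"
    using q(1) by (simp add: quot_carrier)
  moreover have "{const_poly a * q + t | a t. t \<in> ?T} = {p \<in> polys n. \<phi> p \<in> span (insert b B)}"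
  proof (intro equalityI subsetI)
    fix p assume "p \<in> {const_poly a * q + t | a t. t \<in> ?T}"
    then obtain a t where t: "p = const_poly a * q + t" "t \<in> ?T"
      by blast
    then have "\<phi> p - scale a b \<in> span B" "p \<in> polys n"
      using q by (simp_all add: polylinearD(1,2)[OF assms(1)])
    then show "p \<in> {p \<in> polys n. \<phi> p \<in> span (insert b B)}"
      by (auto simp: span_breakdown_eq)
  next
    fix p assume p: "p \<in> {p \<in> polys n. \<phi> p \<in> span (insert b B)}"
    then obtain a where "\<phi> p - scale a b \<in> span B"
      by (auto simp: span_breakdown_eq)
    then have "p - const_poly a * q \<in> ?T"
      using p q by (simp add: polylinearD(2,5)[OF assms(1)])
    then show "p \<in> {const_poly a * q + t | a t. t \<in> ?T}"
      by (intro CollectI exI[of _ a] exI[of _ "p - const_poly a * q"]) simp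
  qed
  moreover have "?T \<subseteq> polys n"
    by blast
  ultimately show ?case
    using ring.Suc_dim[OF ideal.quotient_is_ring[OF assms(3)] _ _ insert.IH[OF B(1)], of "coset n ?J q"]
      line_extension_cosets[OF assms(3) q(1), of ?T]
    by (simp only: card_insert_disjoint[OF insert.hyps] simp_thms)
qed

end

interpretation poly: complex_space "\<lambda>a p. const_poly a * p"
  by unfold_locales (simp_all add: algebra_simps)

lemma subspace_polys: "poly.subspace (polys n)"
  by (rule poly.subspaceI) simp_all

text \<open>
  Representatives of the lines that are added successively form a linearly independent set,
  and its span maps bijectively onto the subspace \<open>E\<close> of the quotient. For the whole
  quotient, the span is a vector space complement of \<open>J\<close>.
\<close>

lemma complement_if_dimension:
  assumes J: "ideal J (poly_ring n)"
    and "ring.dimension (poly_ring n Quot J) d (scalars n J) E"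
  shows "\<exists>T. finite T \<and> card T = d \<and> T \<subseteq> polys n \<and> poly.independent T
    \<and> poly.span T \<inter> J = {0} \<and> E = coset n J ` poly.span T"
proof -
  interpret Q: ring "poly_ring n Quot J"
    by (rule ideal.quotient_is_ring[OF J])
  define K where "K = scalars n J"
  have "Q.dimension d K E"
    using assms(2) by (simp add: K_def)
  then show ?thesis
    using K_def
  proof (induction rule: Q.dimension.induct)
    case (zero_dim K)
    have "coset n J 0 = J"
      by (simp add: a_r_coset_def')
    then show ?case
      using idealD(2)[OF J] by (intro exI[of _ "{}"]) (auto simp: FactRing_def poly.independent_empty)
  next
    case (Suc_dim v E d K)
    then obtain T where T: "finite T" "card T = d" "T \<subseteq> polys n" "poly.independent T"
      "poly.span T \<inter> J = {0}" "E = coset n J ` poly.span T"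
      by blast
    obtain q where q: "q \<in> polys n" "v = coset n J q"
      using Suc_dim(1) by (auto simp: quot_carrier)
    \<comment> \<open>\<open>q\<close> stays outside the span of \<open>T\<close> even modulo \<open>J\<close>; this gives both independence and
      the trivial intersection with \<open>J\<close>.\<close>
    have q_notin: "q - t \<notin> J" if "t \<in> poly.span T" for t
      using Suc_dim(2) that by (auto simp: q(2) T(6) coset_eq_iff[OF J])
    then have q_span: "q \<notin> poly.span T"
      using idealD(2)[OF J] by force
    have span: "poly.span (insert q T) = {const_poly a * q + t | a t. t \<in> poly.span T}"
    proof (intro equalityI subsetI)
      fix p assume "p \<in> poly.span (insert q T)"
      then obtain a where "p - const_poly a * q \<in> poly.span T"
        by (auto simp: poly.span_breakdown_eq)
      then show "p \<in> {const_poly a * q + t | a t. t \<in> poly.span T}"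
        by (intro CollectI exI[of _ a] exI[of _ "p - const_poly a * q"]) simp
    next
      fix p assume "p \<in> {const_poly a * q + t | a t. t \<in> poly.span T}"
      then obtain a t where "p = const_poly a * q + t" "t \<in> poly.span T"
        by blast
      then have "p - const_poly a * q \<in> poly.span T"
        by simp
      then show "p \<in> poly.span (insert q T)"
        unfolding poly.span_breakdown_eq ..
    qed
    have "p = 0" if p: "p \<in> poly.span (insert q T)" "p \<in> J" for p
    proof -
      obtain a t where p_eq: "p = const_poly a * q + t" and t: "t \<in> poly.span T"
        using p(1) span by auto
      have "a = 0"
      proof (rule ccontr)
        assume "a \<noteq> 0"
        \<comment> \<open>Dividing \<open>p\<close> by \<open>a\<close> exhibits \<open>q\<close> as an element of the span of \<open>T\<close> modulo \<open>J\<close>.\<close>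
        let ?b = "const_poly (inverse a)"
        have "?b * p = q - - (?b * t)"
          using \<open>a \<noteq> 0\<close> by (simp add: p_eq distrib_left flip: mult.assoc const_poly_simps(4))
        moreover have "?b * p \<in> J"
          using idealD(4)[OF J p(2)] by simp
        ultimately show False
          using q_notin[of "- (?b * t)"] t by (simp add: poly.span_neg poly.span_scale)
      qed
      then show "p = 0"
        using T(5) t p(2) p_eq by auto
    qed
    then have "poly.span (insert q T) \<inter> J = {0}"
      using idealD(2)[OF J] poly.span_zero by blast
    moreover have "poly.span T \<subseteq> polys n"
      using T(3) subspace_polys by (rule poly.span_minimal)
    then have "Q.line_extension K v E = coset n J ` poly.span (insert q T)"
      using line_extension_cosets[OF J q(1)] by (simp add: Suc_dim(5) q(2) T(6) span)
    moreover have "q \<notin> T"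
      using q_span poly.span_base by blast
    ultimately show ?case
      using T q(1) q_span by (intro exI[of _ "insert q T"]) (simp add: poly.independent_insertI)
  qed
qed

context complex_space
begin

text \<open>
  The surjection is the projection \<open>r\<close> along \<open>J\<close> onto a complement with \<open>c\<close> basis elements,
  followed by a linear isomorphism \<open>f\<close> of the complement with \<open>V\<close>.
\<close>

lemma surj_if_dimension:
  assumes J: "ideal J (poly_ring n)"
    and dim: "ring.dimension (poly_ring n Quot J) c (scalars n J) (carrier (poly_ring n Quot J))"
    and B: "finite B" "card B = c" "independent B" "span B = UNIV"
  shows "\<exists>\<phi>. polylinear n \<phi> \<and> \<phi> ` polys n = UNIV \<and> ker n \<phi> = J"
proof -
  interpret PV: vector_space_pair "\<lambda>a p. const_poly a * p" scale ..
  obtain T where T: "finite T" "card T = c" "T \<subseteq> polys n" "poly.independent T"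
      "poly.span T \<inter> J = {0}" "coset n J ` polys n = coset n J ` poly.span T"
    using complement_if_dimension[OF J dim] by (auto simp: quot_carrier)
  obtain h where h: "bij_betw h T B"
    using finite_same_card_bij[OF T(1) B(1)] T(2) B(2) by auto
  define f where "f = PV.construct T h"
  interpret f: Vector_Spaces.linear "\<lambda>a p. const_poly a * p" scale f
    unfolding f_def using T(4) by (rule PV.linear_construct)
  have "f t = h t" if "t \<in> T" for t
    unfolding f_def using T(4) that by (rule PV.construct_basis)
  then have fT: "bij_betw f T B"
    using h by (simp cong: bij_betw_cong)
  have f_inj: "inj_on f (poly.span T)"
    using fT B(3) T(4) f.inj_on_span_iff_independent_image by (simp add: bij_betw_def)
  have f_surj: "f ` poly.span T = UNIV"
    unfolding f.span_image[symmetric] bij_betw_imp_surj_on[OF fT] by (rule B(4))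
  have span_T: "poly.span T \<subseteq> polys n"
    using T(3) subspace_polys by (rule poly.span_minimal)
  have "\<exists>t. t \<in> poly.span T \<and> p - t \<in> J" if "p \<in> polys n" for p
  proof -
    have "coset n J p \<in> coset n J ` poly.span T"
      using that unfolding T(6)[symmetric] by (rule imageI)
    then show ?thesis
      by (auto simp: coset_eq_iff[OF J])
  qed
  then have "\<forall>p\<in>polys n. \<exists>t. t \<in> poly.span T \<and> p - t \<in> J"
    by simp
  from bchoice[OF this] obtain r where
    r: "\<And>p. p \<in> polys n \<Longrightarrow> r p \<in> poly.span T" "\<And>p. p \<in> polys n \<Longrightarrow> p - r p \<in> J"
    by auto
  have r_eq: "r p = t" if "p \<in> polys n" "t \<in> poly.span T" "p - t \<in> J" for p t
  proof -
    have "(p - t) - (p - r p) \<in> J"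
      using that(3) r(2)[OF that(1)] by (rule idealD(6)[OF J])
    then have "r p - t \<in> poly.span T \<inter> J"
      using poly.span_diff[OF r(1)[OF that(1)] that(2)] by simp
    with T(5) show ?thesis
      by simp
  qed
  have r_add: "r (p + q) = r p + r q" if "p \<in> polys n" "q \<in> polys n" for p q
  proof (rule r_eq)
    show "p + q - (r p + r q) \<in> J"
      using idealD(3)[OF J r(2)[OF that(1)] r(2)[OF that(2)]] by (simp only: add_diff_add)
  qed (use that r(1) poly.span_add in simp_all)
  have r_scale: "r (const_poly a * p) = const_poly a * r p" if "p \<in> polys n" for a p
  proof (rule r_eq)
    show "const_poly a * p - const_poly a * r p \<in> J"
      using idealD(4)[OF J r(2)[OF that] polys_const[of a]] by (simp only: right_diff_distrib)
    show "const_poly a * r p \<in> poly.span T"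
      using r(1)[OF that] by (rule poly.span_scale)
  qed (use that in simp)
  have "polylinear n (f \<circ> r)"
    by (simp add: polylinear_def r_add r_scale f.add f.scale)
  moreover have "(f \<circ> r) ` polys n = UNIV"
  proof -
    have "r t = t" if "t \<in> poly.span T" for t
      using that span_T idealD(2)[OF J] by (intro r_eq) auto
    then have "f t \<in> (f \<circ> r) ` polys n" if "t \<in> poly.span T" for t
      using that span_T by (intro image_eqI[of _ _ t]) auto
    then have "f ` poly.span T \<subseteq> (f \<circ> r) ` polys n"
      by (rule image_subsetI)
    then show ?thesis
      unfolding f_surj by (rule top.extremum_uniqueI)
  qed
  moreover have "ker n (f \<circ> r) = J"
  proof -
    have "f (r p) = 0 \<longleftrightarrow> p \<in> J" if p: "p \<in> polys n" for p
    proof -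
      have "f (r p) = 0 \<longleftrightarrow> r p = 0"
        using inj_onD[OF f_inj, of "r p" 0] r(1)[OF p] by (auto simp: poly.span_zero f.zero)
      also have "\<dots> \<longleftrightarrow> p \<in> J"
        using r(2)[OF p] r_eq[OF p, of 0] by (auto simp: poly.span_zero)
      finally show ?thesis .
    qed
    then show ?thesis
      using idealD(1)[OF J] by (auto simp: ker_def)
  qed
  ultimately show ?thesis
    by (intro exI[of _ "f \<circ> r"] conjI)
qed

end

section \<open>Stable tuples modulo base change\<close>

lemma GL_iff: "g \<in> carrier (GL s) \<longleftrightarrow> Vector_Spaces.linear s s g \<and> bij g"
  by (simp add: GL_def Hom_def)

lemma tuple_action_comp:
  assumes "bij g" "bij h"
  shows "tuple_action n (h \<circ> g) X = tuple_action n h (tuple_action n g X)"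
proof -
  have "inv_into UNIV (h \<circ> g) = inv_into UNIV g \<circ> inv_into UNIV h"
    using assms by (simp add: o_inv_distrib)
  then show ?thesis
    by (cases X) (simp add: tuple_action_def comp_assoc restrict_def fun_eq_iff)
qed

locale stable_setting = complex_space scale + W: vector_space scaleW
  for scale :: "complex \<Rightarrow> 'v::ab_group_add \<Rightarrow> 'v"
    and scaleW :: "complex \<Rightarrow> 'w::ab_group_add \<Rightarrow> 'w" +
  fixes n c :: nat and basis :: "'v set" and w :: 'w
  assumes basis: "finite basis" "card basis = c" "independent basis" "span basis = UNIV"
    and w: "w \<noteq> 0" "range (\<lambda>a. scaleW a w) = UNIV"
begin

abbreviation stables :: "('v, 'w) tuple set"
  where "stables \<equiv> stable_tuples n scale scaleW"

text \<open>
  The annihilator of the generator \<open>I w\<close>: the ideal that corresponds to the tuple.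
\<close>

definition relations :: "('v, 'w) tuple \<Rightarrow> cpoly set"
  where "relations = (\<lambda>(B, I). ker n (eval n B (I w)))"

lemma W_obtain:
  obtains a where "x = scaleW a w"
proof -
  have "x \<in> range (\<lambda>a. scaleW a w)"
    unfolding w(2) by simp
  then show thesis
    using that by blast
qed

lemma range_Hom:
  assumes "I \<in> Hom scaleW scale"
  shows "range I = range (\<lambda>a. scale a (I w))"
proof -
  interpret I: Vector_Spaces.linear scaleW scale I
    using assms by (simp add: Hom_def)
  have "range I = I ` range (\<lambda>a. scaleW a w)"
    using w(2) by simp
  also have "\<dots> = range (\<lambda>a. scale a (I w))"
    by (simp add: image_image I.scale)
  finally show ?thesis .
qed

lemma stablesD:
  assumes "(B, I) \<in> stables"
  shows "I \<in> Hom scaleW scale" "B \<in> extensional {..<n}" "\<And>i. i < n \<Longrightarrow> lin (B i)"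
    and "presents n B (I w) (eval n B (I w))" "eval n B (I w) ` polys n = UNIV"
proof -
  show I: "I \<in> Hom scaleW scale" and "B \<in> extensional {..<n}" and lin: "\<And>i. i < n \<Longrightarrow> lin (B i)"
    using assms by (auto simp: stable_tuples_def commuting_tuples_def Hom_def PiE_iff)
  have "B i (B j x) = B j (B i x)" if "i < n" "j < n" for i j x
  proof (cases "i = j")
    case False
    then have "commutator (B i) (B j) = (\<lambda>_. 0)"
      using assms that by (simp add: stable_tuples_def commuting_tuples_def)
    then have "commutator (B i) (B j) x = 0"
      by simp
    then show ?thesis
      by (simp add: commutator_def)
  qed simp
  then show pres: "presents n B (I w) (eval n B (I w))"
    using lin by (rule presents_eval)
  show "eval n B (I w) ` polys n = UNIV"
    using stable_iff_surj[OF pres range_Hom[OF I]] assms by (simp add: stable_tuples_def)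
qed

lemma relations_in_Hilb:
  assumes "X \<in> stables"
  shows "relations X \<in> Hilb n c"
proof -
  obtain B I where X: "X = (B, I)"
    by (cases X)
  note st = stablesD[OF assms[unfolded X]]
  have J: "ideal (ker n (eval n B (I w))) (poly_ring n)"
    using st(4,3) by (rule ideal_ker)
  have "polylinear n (eval n B (I w))"
    using st(4) by (simp add: presents_def)
  from dimension_if_surj[OF this st(5) J basis(1,3)] J show ?thesis
    by (simp add: Hilb_def X relations_def basis(2,4) quot_carrier)
qed

text \<open>
  If \<open>\<phi>\<close> is the evaluation map of \<open>X\<close>, then \<open>g \<circ> \<phi>\<close> satisfies the equations that characterize
  the evaluation map of \<open>g \<cdot> X\<close>, and \<open>g\<close> is injective.
\<close>

lemma relations_action:
  assumes X: "X \<in> stables" and Y: "tuple_action n g X \<in> stables" and g: "lin g" "bij g"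
  shows "relations (tuple_action n g X) = relations X"
proof -
  obtain B I where X_eq: "X = (B, I)"
    by (cases X)
  define B' where "B' = (\<lambda>i\<in>{..<n}. g \<circ> B i \<circ> inv_into UNIV g)"
  have Y_eq: "tuple_action n g X = (B', g \<circ> I)"
    by (simp add: X_eq B'_def tuple_action_def)
  note st = stablesD[OF X[unfolded X_eq]]
  note st' = stablesD[OF Y[unfolded Y_eq]]
  interpret g: Vector_Spaces.linear scale scale g
    by (rule g(1))
  have inv: "inv_into UNIV g (g x) = x" for x
    using g(2) by (simp add: bij_is_inj)
  let ?\<phi> = "eval n B (I w)"
  have \<phi>: "polylinear n ?\<phi>" "?\<phi> 1 = I w"
    "\<And>i p. i < n \<Longrightarrow> p \<in> polys n \<Longrightarrow> ?\<phi> (var i * p) = B i (?\<phi> p)"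
    using st(4) by (simp_all add: presents_def)
  have "polylinear n (g \<circ> ?\<phi>)"
    by (simp add: polylinear_def polylinearD(1,2)[OF \<phi>(1)] g.add g.scale)
  then have "presents n B' ((g \<circ> I) w) (g \<circ> ?\<phi>)"
    by (simp add: presents_def \<phi>(2,3) B'_def inv)
  then have eq: "eval n B' ((g \<circ> I) w) p = g (?\<phi> p)" if "p \<in> polys n" for p
    using presents_unique[OF st'(4) _ that] by simp
  have g0: "g x = 0 \<longleftrightarrow> x = 0" for x
    using inv[of x] inv[of 0] g.zero by metis
  show ?thesis
    unfolding Y_eq by (auto simp: X_eq relations_def ker_def eq[simplified] g0)
qed

text \<open>
  Each of the two evaluation maps factors through the other because their kernels agree. The
  two factors \<open>g\<close> and \<open>h\<close> are inverse to each other, and \<open>g\<close> intertwines the two module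
  structures and their generators.
\<close>

lemma same_orbit_if_relations_eq:
  assumes X: "X \<in> stables" and Y: "Y \<in> stables" and eq: "relations X = relations Y"
  shows "\<exists>g\<in>carrier (GL scale). Y = tuple_action n g X"
proof -
  obtain B I B' I' where XY: "X = (B, I)" "Y = (B', I')"
    by (cases X, cases Y)
  note st = stablesD[OF X[unfolded XY]]
  note st' = stablesD[OF Y[unfolded XY]]
  define \<phi> where "\<phi> = eval n B (I w)"
  define \<psi> where "\<psi> = eval n B' (I' w)"
  have \<phi>: "polylinear n \<phi>" "\<phi> 1 = I w" "\<phi> ` polys n = UNIV"
    "\<And>i p. i < n \<Longrightarrow> p \<in> polys n \<Longrightarrow> \<phi> (var i * p) = B i (\<phi> p)"
    using st(4,5) by (simp_all add: presents_def flip: \<phi>_def)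
  have \<psi>: "polylinear n \<psi>" "\<psi> 1 = I' w" "\<psi> ` polys n = UNIV"
    "\<And>i p. i < n \<Longrightarrow> p \<in> polys n \<Longrightarrow> \<psi> (var i * p) = B' i (\<psi> p)"
    using st'(4,5) by (simp_all add: presents_def flip: \<psi>_def)
  have ker: "ker n \<phi> = ker n \<psi>"
    using eq by (simp add: XY relations_def \<phi>_def \<psi>_def)
  obtain g where g: "lin g" "\<And>p. p \<in> polys n \<Longrightarrow> g (\<phi> p) = \<psi> p"
    using factor_through_surj[OF \<phi>(1,3) \<psi>(1)] ker by auto
  obtain h where h: "\<And>p. p \<in> polys n \<Longrightarrow> h (\<psi> p) = \<phi> p"
    using factor_through_surj[OF \<psi>(1,3) \<phi>(1)] ker by auto
  have \<phi>_obtain: "\<exists>p\<in>polys n. x = \<phi> p" for x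
  proof -
    have "x \<in> \<phi> ` polys n"
      unfolding \<phi>(3) by simp
    then show ?thesis
      by blast
  qed
  have \<psi>_obtain: "\<exists>p\<in>polys n. x = \<psi> p" for x
  proof -
    have "x \<in> \<psi> ` polys n"
      unfolding \<psi>(3) by simp
    then show ?thesis
      by blast
  qed
  have "h (g x) = x" for x
    using \<phi>_obtain[of x] by (auto simp: g h)
  moreover have gh: "g (h x) = x" for x
    using \<psi>_obtain[of x] by (auto simp: g h)
  ultimately have "bij g"
    by (intro o_bij[of h]) auto
  then have inv: "inv_into UNIV g x = h x" for x
    using gh by (metis bij_inv_eq_iff)
  interpret g: Vector_Spaces.linear scale scale g
    by (rule g(1))
  interpret I: Vector_Spaces.linear scaleW scale I
    using st(1) by (simp add: Hom_def)
  interpret I': Vector_Spaces.linear scaleW scale I'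
    using st'(1) by (simp add: Hom_def)
  have "g (B i (h x)) = B' i x" if "i < n" for i x
  proof -
    obtain p where p: "p \<in> polys n" "x = \<psi> p"
      using \<psi>_obtain by blast
    have "g (B i (h x)) = g (\<phi> (var i * p))"
      using p that by (simp add: h \<phi>(4))
    also have "\<dots> = B' i x"
      using p that by (simp add: g \<psi>(4))
    finally show ?thesis .
  qed
  then have "(\<lambda>i\<in>{..<n}. g \<circ> B i \<circ> inv_into UNIV g) = B'"
    using st'(2) by (auto simp: fun_eq_iff extensional_def inv)
  moreover have "g \<circ> I = I'"
  proof
    fix x
    obtain a where "x = scaleW a w"
      by (rule W_obtain)
    then show "(g \<circ> I) x = I' x"
      using g(2)[of 1] by (simp add: I.scale I'.scale g.scale \<phi>(2) \<psi>(2))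
  qed
  ultimately have "Y = tuple_action n g X"
    by (simp add: XY tuple_action_def)
  then show ?thesis
    using g(1) \<open>bij g\<close> GL_iff by blast
qed

text \<open>
  A linear isomorphism \<open>R/J \<cong> V\<close> transports multiplication by \<open>z\<^sub>i\<close> to the operator \<open>B\<^sub>i\<close> and the
  class of \<open>1\<close> to the generator. The operators exist because \<open>J\<close> is closed under multiplication
  by \<open>z\<^sub>i\<close>, and they commute because the variables do.
\<close>

lemma Hilb_is_relations:
  assumes "J \<in> Hilb n c"
  shows "\<exists>X\<in>stables. relations X = J"
proof -
  have J: "ideal J (poly_ring n)"
    using assms by (simp add: Hilb_def)
  obtain \<phi> where \<phi>: "polylinear n \<phi>" "\<phi> ` polys n = UNIV" "ker n \<phi> = J"
    using surj_if_dimension[OF J _ basis] assms by (auto simp: Hilb_def)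
  have "\<exists>b. lin b \<and> (\<forall>p\<in>polys n. b (\<phi> p) = \<phi> (var i * p))" if i: "i < n" for i
  proof (rule factor_through_surj[OF \<phi>(1,2)])
    show "polylinear n (\<lambda>p. \<phi> (var i * p))"
      using i by (simp add: polylinear_def distrib_left polylinearD(1,2)[OF \<phi>(1)]
          mult.left_commute[of "var i" "const_poly _"])
    show "ker n \<phi> \<subseteq> ker n (\<lambda>p. \<phi> (var i * p))"
    proof
      fix p assume p: "p \<in> ker n \<phi>"
      then have "var i * p \<in> ker n \<phi>"
        using idealD(4)[OF J] i \<phi>(3) by simp
      with p show "p \<in> ker n (\<lambda>p. \<phi> (var i * p))"
        by (simp add: ker_def)
    qed
  qed
  then obtain b where b: "\<And>i. i < n \<Longrightarrow> lin (b i)"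
    "\<And>i p. i < n \<Longrightarrow> p \<in> polys n \<Longrightarrow> b i (\<phi> p) = \<phi> (var i * p)"
    by metis
  define B where "B = restrict b {..<n}"
  interpret WV: vector_space_pair scaleW scale ..
  have ind: "W.independent {w}"
    using w(1) by simp
  define I where "I = WV.construct {w} (\<lambda>_. \<phi> 1)"
  have I: "I \<in> Hom scaleW scale" "I w = \<phi> 1"
    using WV.linear_construct[OF ind] WV.construct_basis[OF ind] by (simp_all add: Hom_def I_def)
  have pres: "presents n B (I w) \<phi>"
    by (simp add: presents_def \<phi>(1) I(2) B_def b(2))
  have "commutator (B i) (B j) = (\<lambda>_. 0)" if "i < n" "j < n" for i j
  proof
    fix x
    have "x \<in> \<phi> ` polys n"
      unfolding \<phi>(2) by simp
    then obtain p where "p \<in> polys n" "x = \<phi> p"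
      by blast
    with that show "commutator (B i) (B j) x = 0"
      by (simp add: commutator_def B_def b(2) mult.left_commute)
  qed
  moreover have "B \<in> {..<n} \<rightarrow>\<^sub>E Hom scale scale"
    by (auto simp: B_def Hom_def b(1))
  ultimately have "(B, I) \<in> commuting_tuples n scale scaleW"
    using I(1) by (simp add: commuting_tuples_def)
  moreover have "stable n scale (B, I)"
    using stable_iff_surj[OF pres range_Hom[OF I(1)]] \<phi>(2) by simp
  ultimately have X: "(B, I) \<in> stables"
    by (simp add: stable_tuples_def)
  have "eval n B (I w) p = \<phi> p" if "p \<in> polys n" for p
    using presents_unique[OF stablesD(4)[OF X] pres that] .
  then have "relations (B, I) = J"
    using \<phi>(3) by (auto simp: relations_def ker_def)
  with X show ?thesis
    by blast
qed

lemma self_in_orbit: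
  assumes "X \<in> stables"
  shows "X \<in> orbit (GL scale) (tuple_action n) X"
proof -
  obtain B I where X: "X = (B, I)"
    by (cases X)
  have "tuple_action n id X = X"
    using stablesD(2)[OF assms[unfolded X]]
    by (auto simp: X tuple_action_def fun_eq_iff extensional_def)
  moreover have "id \<in> carrier (GL scale)"
    by (simp add: GL_iff linear_id)
  ultimately show ?thesis
    unfolding orbit_def by force
qed

lemma orbit_subset:
  assumes "g \<in> carrier (GL scale)"
  shows "orbit (GL scale) (tuple_action n) (tuple_action n g X) \<subseteq> orbit (GL scale) (tuple_action n) X"
proof
  fix Z assume "Z \<in> orbit (GL scale) (tuple_action n) (tuple_action n g X)"
  then obtain h where h: "h \<in> carrier (GL scale)" "Z = tuple_action n h (tuple_action n g X)"
    by (auto simp: orbit_def)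
  have "h \<circ> g \<in> carrier (GL scale)"
    using assms h(1) Vector_Spaces.linear_compose[of scale scale g scale h] by (simp add: GL_iff bij_comp)
  moreover have "Z = tuple_action n (h \<circ> g) X"
    using assms h by (simp add: GL_iff tuple_action_comp)
  ultimately show "Z \<in> orbit (GL scale) (tuple_action n) X"
    unfolding orbit_def by blast
qed

text \<open>
  The representative is taken among the stable tuples of the orbit, where \<open>relations\<close> is
  constant (\<open>relations_action\<close>).
\<close>

definition orbit_relations :: "('v, 'w) tuple set \<Rightarrow> cpoly set"
  where "orbit_relations \<O> = relations (SOME X. X \<in> stables \<and> X \<in> \<O>)"

lemma orbit_relations_orbit:
  assumes "X \<in> stables"
  shows "orbit_relations (orbit (GL scale) (tuple_action n) X) = relations X"
proof -
  let ?Y = "SOME Y. Y \<in> stables \<and> Y \<in> orbit (GL scale) (tuple_action n) X"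
  have Y: "?Y \<in> stables \<and> ?Y \<in> orbit (GL scale) (tuple_action n) X"
    by (rule someI[of _ X]) (rule conjI[OF assms self_in_orbit[OF assms]])
  then obtain g where g: "g \<in> carrier (GL scale)" "?Y = tuple_action n g X"
    unfolding orbit_def by blast
  have "relations ?Y = relations X"
    using relations_action[OF assms, of g] Y g(1) unfolding g(2) GL_iff by blast
  then show ?thesis
    by (simp add: orbit_relations_def)
qed

lemma bij_betw_orbit_relations:
  "bij_betw orbit_relations (moduli_space n scale scaleW) (Hilb n c)"
proof (rule bij_betw_imageI)
  let ?orb = "orbit (GL scale) (tuple_action n)"
  have moduli: "moduli_space n scale scaleW = ?orb ` stables"
    unfolding moduli_space_def orbits_def by (rule Setcompr_eq_image)
  have sub: "?orb Y \<subseteq> ?orb X"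
    if "X \<in> stables" "Y \<in> stables" "relations X = relations Y" for X Y
    using same_orbit_if_relations_eq[OF that] orbit_subset by blast
  show "inj_on orbit_relations (moduli_space n scale scaleW)"
    unfolding moduli
  proof (rule inj_onI, elim imageE)
    fix \<O> \<P> X Y
    assume XY: "X \<in> stables" "Y \<in> stables" and eqs: "\<O> = ?orb X" "\<P> = ?orb Y"
      and "orbit_relations \<O> = orbit_relations \<P>"
    then have "relations X = relations Y"
      by (simp add: orbit_relations_orbit)
    then show "\<O> = \<P>"
      unfolding eqs using sub XY by (intro subset_antisym) simp_all
  qed
  have "orbit_relations ` moduli_space n scale scaleW = relations ` stables"
    unfolding moduli image_image by (intro image_cong refl orbit_relations_orbit)
  also have "\<dots> = Hilb n c"
    using relations_in_Hilb Hilb_is_relations by blast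
  finally show "orbit_relations ` moduli_space n scale scaleW = Hilb n c" .
qed

end

text \<open>
  A basis of \<open>V\<close> and a generator of the line \<open>W\<close> are all that has to be chosen; a positive
  dimension guarantees that the basis is finite, as infinite sets have cardinality \<open>0\<close>.
\<close>

theorem theorem2p5:
  fixes n c :: nat
    and scaleV :: "complex \<Rightarrow> 'v::ab_group_add \<Rightarrow> 'v"
    and scaleW :: "complex \<Rightarrow> 'w::ab_group_add \<Rightarrow> 'w"
  assumes "n > 0" and "c > 0"
    and "vector_space scaleV" and "vector_space.dim scaleV UNIV = c"
    and "vector_space scaleW" and "vector_space.dim scaleW UNIV = 1"
  shows "\<exists>f. bij_betw f (moduli_space n scaleV scaleW) (Hilb n c)"
proof -
  interpret V: vector_space scaleV by fact
  interpret W: vector_space scaleW by fact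
  obtain E where E: "V.independent E" "UNIV \<subseteq> V.span E" "card E = c"
    using V.basis_exists[of UNIV] assms(4) by metis
  moreover have "finite E"
    using E(3) assms(2) card.infinite by fastforce
  moreover obtain F where F: "W.independent F" "UNIV \<subseteq> W.span F" "card F = 1"
    using W.basis_exists[of UNIV] assms(6) by metis
  moreover obtain w where "F = {w}"
    using F(3) by (auto simp: card_1_singleton_iff)
  ultimately interpret stable_setting scaleV scaleW n c E w
    by unfold_locales (auto simp: W.span_singleton)
  show ?thesis
    using bij_betw_orbit_relations by blast
qed

end
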